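(* Let $F_1, F_2\colon \mathbb{R}^n\rightrightarrows \mathbb{R}^p$ be nearly convex set-valued mappings such that $\mathrm{ri}(\mathrm{dom}\, F_1)\cap \mathrm{ri}(\mathrm{dom}\, F_2)\neq\emptyset$, and let $(\bar x,\bar y)\in\mathrm{gph}(F_1+F_2)$. Then the equality $$D^*(F_1+F_2)(\bar x,\bar y)(v)=D^*F_1(\bar x,\bar y_1)(v)+D^*F_2(\bar x,\bar y_2)(v)$$ holds for every $v\in\mathbb{R}^p$ and every $(\bar y_1,\bar y_2)\in S(\bar x,\bar y)$, where $$S(\bar x,\bar y)=\big\{(\bar y_1,\bar y_2)\in\mathbb{R}^p\times\mathbb{R}^p\;\big|\;\bar y=\bar y_1+\bar y_2,\ \bar y_i\in F_i(\bar x),\ i=1,2\big\}.$$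
   Context: A set $\Omega\subset\mathbb{R}^k$ is nearly convex if there exists a convex set $C\subset\mathbb{R}^k$ such that $C\subset\Omega\subset\overline{C}$, where $\overline{C}$ is the closure of $C$. For an arbitrary set $\Omega\subset\mathbb{R}^k$, the relative interior is $\mathrm{ri}\,\Omega=\{a\in\Omega \mid \text{there exists } \delta>0 \text{ with } B(a;\delta)\cap \mathrm{aff}\,\Omega\subset\Omega\}$, where $\mathrm{aff}\,\Omega$ is the affine hull and $B(a;\delta)$ the open ball. A set-valued mapping $F\colon\mathbb{R}^n\rightrightarrows\mathbb{R}^p$ assigns to each $x\in\mathbb{R}^n$ a (possibly empty) subset $F(x)\subset\mathbb{R}^p$; $\mathrm{dom}\,F=\{x\mid F(x)\neq\emptyset\}$ and $\mathrm{gph}\,F=\{(x,y)\in\mathbb{R}^n\times\mathbb{R}^p\mid y\in F(x)\}$. $F$ is nearly convex if $\mathrm{gph}\,F$ is a nearly convex set. The sum is $(F_1+F_2)(x)=\{y_1+y_2\mid y_1\in F_1(x),\ y_2\in F_2(x)\}$; under the stated hypotheses $F_1+F_2$ is nearly convex. The normal cone to a nearly convex set $\Omega\subset\mathbb{R}^k$ at $\bar z\in\Omega$ is $N(\bar z;\Omega)=\{w\in\mathbb{R}^k\mid \langle w,z-\bar z\rangle\le 0 \text{ for all } z\in\Omega\}$. The coderivative of a nearly convex set-valued mapping $F$ at $(\bar x,\bar y)\in\mathrm{gph}\,F$ is the set-valued mapping $D^*F(\bar x,\bar y)\colon\mathbb{R}^p\rightrightarrows\mathbb{R}^n$ given by $D^*F(\bar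 x,\bar y)(v)=\{u\in\mathbb{R}^n\mid (u,-v)\in N((\bar x,\bar y);\mathrm{gph}\,F)\}$. The sum of two sets is the Minkowski sum. *)

theory Defs
  imports "HOL-Analysis.Analysis"
begin

definition nearly_convex :: "'a::real_normed_vector set \<Rightarrow> bool" where
  "nearly_convex \<Omega> \<longleftrightarrow> (\<exists>C. convex C \<and> C \<subseteq> \<Omega> \<and> \<Omega> \<subseteq> closure C)"

text \<open>A set-valued mapping from \<^term>\<open>UNIV :: 'a set\<close> to \<^term>\<open>UNIV :: 'b set\<close> is a function
  of type \<^typ>\<open>'a \<Rightarrow> 'b set\<close>; empty values are allowed.\<close>

definition sv_dom :: "('a \<Rightarrow> 'b set) \<Rightarrow> 'a set" where
  "sv_dom F = {x. F x \<noteq> {}}"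

definition sv_gph :: "('a \<Rightarrow> 'b set) \<Rightarrow> ('a \<times> 'b) set" where
  "sv_gph F = {(x, y). y \<in> F x}"

definition sv_nearly_convex ::
    "('a::real_normed_vector \<Rightarrow> 'b::real_normed_vector set) \<Rightarrow> bool" where
  "sv_nearly_convex F \<longleftrightarrow> nearly_convex (sv_gph F)"

definition sv_sum :: "('a \<Rightarrow> 'b::plus set) \<Rightarrow> ('a \<Rightarrow> 'b set) \<Rightarrow> 'a \<Rightarrow> 'b set" where
  "sv_sum F1 F2 x = {y1 + y2 | y1 y2. y1 \<in> F1 x \<and> y2 \<in> F2 x}"

text \<open>The normal cone is meant for nearly convex \<open>\<Omega>\<close> and \<open>z \<in> \<Omega>\<close>, and the coderivative for
  nearly convex \<open>F\<close> at \<open>(x, y) \<in> sv_gph F\<close>. The definitions are total; elsewhere they carry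
  no intended meaning.\<close>

definition normal_cone :: "'a::real_inner \<Rightarrow> 'a set \<Rightarrow> 'a set" where
  "normal_cone z \<Omega> = {w. \<forall>z'\<in>\<Omega>. w \<bullet> (z' - z) \<le> 0}"

definition coderivative ::
    "('a::real_inner \<Rightarrow> 'b::real_inner set) \<Rightarrow> 'a \<times> 'b \<Rightarrow> 'b \<Rightarrow> 'a set" where
  "coderivative F z v = {u. (u, - v) \<in> normal_cone z (sv_gph F)}"

definition sum_decompositions ::
    "('a \<Rightarrow> 'b::plus set) \<Rightarrow> ('a \<Rightarrow> 'b set) \<Rightarrow> 'a \<times> 'b \<Rightarrow> ('b \<times> 'b) set" where
  "sum_decompositions F1 F2 = (\<lambda>(x, y). {(y1, y2). y = y1 + y2 \<and> y1 \<in> F1 x \<and> y2 \<in> F2 x})"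

end

theory Submission
  imports Defs
begin

text \<open>The constraint that both summands are evaluated at the same point is dualized. Pick convex
  sets \<open>C1\<close>, \<open>C2\<close> dense in the two graphs. If \<open>u\<close> lies in the coderivative of the sum, the affine
  function \<open>v \<bullet> (b1 - y1) + v \<bullet> (b2 - y2) - u \<bullet> (a1 - x)\<close> of \<open>((a1, b1), (a2, b2)) \<in> C1 \<times> C2\<close> is
  nonnegative wherever \<open>a1 = a2\<close>. The condition on the domains is a Slater condition for this
  constraint, so there is a multiplier \<open>w\<close> such that adding \<open>w \<bullet> (a1 - a2)\<close> makes the function
  nonnegative on \<open>C1 \<times> C2\<close> and, by continuity, on the product of the graphs. Fixing either factor
  at \<open>(x, y1)\<close> or \<open>(x, y2)\<close> yields the decomposition \<open>u = (u - w) + w\<close>.\<close>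

text \<open>Sets trapped between \<open>S\<close> and \<open>closure S\<close> share one affine
  hull, so relative interiors are monotone among them, and closing the convex set \<open>S\<close>
  leaves its relative interior unchanged. \<open>T\<close> itself may fail to be convex, as domains
  of nearly convex mappings may.\<close>

lemma rel_interior_subset_of_between_closure:
  fixes S T :: "'a::euclidean_space set"
  assumes "convex S" "S \<subseteq> T" "T \<subseteq> closure S"
  shows "rel_interior T \<subseteq> rel_interior S"
proof -
  have "affine hull T = affine hull closure S"
    using hull_mono[OF assms(2), of affine] hull_mono[OF assms(3), of affine] by auto
  then have "rel_interior T \<subseteq> rel_interior (closure S)"
    by (rule subset_rel_interior[OF assms(3)])
  then show ?thesis
    using convex_rel_interior_closure[OF assms(1)] by simp
qed

text \<open>A linear functional minimized over \<open>S\<close> at a relative interior point is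
  constant on \<open>S\<close>: the segment from \<open>d\<close> to \<open>0\<close> can be
  prolonged within \<open>S\<close> past \<open>0\<close>, where the sign of the functional
  flips.\<close>

lemma inner_eq_0_if_nonneg_rel_interior:
  fixes S :: "'a::euclidean_space set"
  assumes "convex S" "0 \<in> rel_interior S" "\<And>d. d \<in> S \<Longrightarrow> 0 \<le> w \<bullet> d" "d \<in> S"
  shows "w \<bullet> d = 0"
proof -
  have "S \<noteq> {}" using assms(4) by auto
  then obtain e where e: "e > 1" "(1 - e) *\<^sub>R d \<in> S"
    using convex_rel_interior_iff[OF assms(1), of 0] assms(2,4) by auto
  from assms(3)[OF e(2)] have "0 \<le> (1 - e) * (w \<bullet> d)" by simp
  with e(1) have "w \<bullet> d \<le> 0" by (simp add: zero_le_mult_iff)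
  with assms(3)[OF assms(4)] show ?thesis by simp
qed

lemma convex_strict_epigraph_linear_image:
  fixes A :: "'a::real_vector \<Rightarrow> 'b::real_vector" and h :: "'a \<Rightarrow> real"
  assumes "linear A" "convex_on K h"
  shows "convex {(A k, r) |k r. k \<in> K \<and> h k < r}"
proof (rule convexI)
  fix p q and s t :: real
  assume "p \<in> {(A k, r) |k r. k \<in> K \<and> h k < r}" "q \<in> {(A k, r) |k r. k \<in> K \<and> h k < r}"
    and st: "0 \<le> s" "0 \<le> t" "s + t = 1"
  then obtain k1 r1 k2 r2 where
    p: "p = (A k1, r1)" "k1 \<in> K" "h k1 < r1" and q: "q = (A k2, r2)" "k2 \<in> K" "h k2 < r2"
    by auto
  have "s *\<^sub>R k1 + t *\<^sub>R k2 \<in> K"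
    using convex_on_imp_convex[OF assms(2)] p q st by (auto simp: convex_def)
  moreover have "h (s *\<^sub>R k1 + t *\<^sub>R k2) \<le> s * h k1 + t * h k2"
    using assms(2) p(2) q(2) st by (auto simp: convex_on_def)
  moreover have "s * h k1 + t * h k2 < s * r1 + t * r2"
    \<comment> \<open>Applied to the differences, the bound stays strict even when \<open>s\<close>
      or \<open>t\<close> is zero.\<close>
    using convex_bound_lt[of "h k1 - r1" 0 "h k2 - r2" s t] p(3) q(3) st
    by (simp add: algebra_simps)
  ultimately show "s *\<^sub>R p + t *\<^sub>R q \<in> {(A k, r) |k r. k \<in> K \<and> h k < r}"
    using p(1) q(1) assms(1) by (force simp: linear_add linear_scale)
qed

text \<open>The origin is separated from the set of pairs (constraint value, number above the
  objective value). The relative interior assumption rules out a vertical hyperplane, so the normal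
  can be scaled to have last coordinate 1; its other component is then the multiplier.\<close>

lemma lagrange_multiplier_exists:
  fixes A :: "'a::euclidean_space \<Rightarrow> 'b::euclidean_space" and h :: "'a \<Rightarrow> real"
  assumes "linear A" "convex_on K h" "0 \<in> rel_interior (A ` K)"
    and nonneg: "\<forall>k\<in>K. A k = 0 \<longrightarrow> 0 \<le> h k"
  obtains w where "\<forall>k\<in>K. 0 \<le> h k + w \<bullet> A k"
proof -
  \<comment> \<open>With the strict inequality, \<open>0\<close> is outside \<open>E\<close> even if
    \<open>h\<close> attains the value 0 at a feasible point.\<close>
  define E where "E = {(A k, r) |k r. k \<in> K \<and> h k < r}"
  obtain k0 where k0: "k0 \<in> K" using assms(3) rel_interior_subset by blast
  have mem: "(A k, r) \<in> E" if "k \<in> K" "h k < r" for k r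
    using that by (auto simp: E_def)
  have "convex E"
    unfolding E_def by (rule convex_strict_epigraph_linear_image[OF assms(1,2)])
  moreover have "E \<noteq> {}"
    using mem[OF k0 less_add_one] by auto
  moreover have "0 \<notin> E"
    using nonneg by (fastforce simp: E_def zero_prod_def)
  \<comment> \<open>Choosing the normal in \<open>span E\<close> excludes a hyperplane that contains
    all of \<open>E\<close>; this is used to show that \<open>b\<close> is nonzero.\<close>
  ultimately obtain a where a: "a \<in> span E" "a \<noteq> 0" "\<And>e. e \<in> E \<Longrightarrow> 0 \<le> a \<bullet> e"
    using separating_hyperplane_set_0_inspan by metis
  obtain w b where wb: "a = (w, b)" by (cases a)
  have sep: "0 \<le> w \<bullet> A k + b * r" if "k \<in> K" "h k < r" for k r
    using a(3)[OF mem[OF that]] by (simp add: wb)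
  have "b \<ge> 0"
  proof (rule ccontr)
    assume "\<not> b \<ge> 0"
    then have b: "b < 0" by simp
    \<comment> \<open>The second entry is large enough to push
      \<open>w \<bullet> A k0 + b * r\<close> down to -1 or below.\<close>
    define r where "r = max (h k0 + 1) ((w \<bullet> A k0 + 1) / (- b))"
    have "(w \<bullet> A k0 + 1) / (- b) \<le> r" "h k0 < r" by (auto simp: r_def)
    then have "w \<bullet> A k0 + 1 \<le> r * (- b)"
      using b by (subst (asm) pos_divide_le_eq) auto
    with sep[OF k0 \<open>h k0 < r\<close>] show False by (simp add: mult.commute)
  qed
  \<comment> \<open>If \<open>b\<close> were 0, then \<open>w\<close> would be nonnegative on the
    image of \<open>K\<close> and hence vanish there. So \<open>a\<close> would be orthogonal to
    \<open>E\<close>, thus to \<open>span E\<close> and to itself.\<close>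
  moreover have "b \<noteq> 0"
  proof
    assume b: "b = 0"
    have "convex (A ` K)"
      using assms(1,2) by (simp add: convex_linear_image convex_on_imp_convex)
    moreover have "0 \<le> w \<bullet> d" if "d \<in> A ` K" for d
      using that sep[OF _ less_add_one] b by auto
    ultimately have "w \<bullet> A k = 0" if "k \<in> K" for k
      using inner_eq_0_if_nonneg_rel_interior[OF _ assms(3)] that by blast
    then have "orthogonal a e" if "e \<in> E" for e
      using that by (auto simp: E_def orthogonal_def wb b)
    then have "orthogonal a a"
      using orthogonal_to_span[OF a(1)] by blast
    with a(2) show False by (simp add: orthogonal_def)
  qed
  ultimately have b: "b > 0" by simp
  have "0 \<le> h k + (w /\<^sub>R b) \<bullet> A k" if "k \<in> K" for k
  proof -
    \<comment> \<open>Letting \<open>r\<close> decrease to \<open>h k\<close> recovers the bound for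
      the objective value itself.\<close>
    have "- ((w \<bullet> A k) / b) \<le> r" if "h k < r" for r
      using sep[OF \<open>k \<in> K\<close> that] b by (simp add: field_simps)
    then have "- ((w \<bullet> A k) / b) \<le> h k" by (rule dense_ge)
    then show ?thesis by (simp add: divide_inverse mult.commute)
  qed
  then have "\<forall>k\<in>K. 0 \<le> h k + (w /\<^sub>R b) \<bullet> A k" by blast
  then show ?thesis by (rule that)
qed

text \<open>For convex sets the relative interior commutes with linear images and with products. A
  common point of the two projected relative interiors therefore lifts to a pair of relative
  interior points with equal first components.\<close>

lemma zero_in_rel_interior_fst_diff:
  fixes C1 C2 :: "('a::euclidean_space \<times> 'b::euclidean_space) set"
  assumes "convex C1" "convex C2"
    and "rel_interior (fst ` C1) \<inter> rel_interior (fst ` C2) \<noteq> {}"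
  shows "0 \<in> rel_interior ((\<lambda>(p, q). fst p - fst q) ` (C1 \<times> C2))"
proof -
  have lin: "linear (\<lambda>(p :: 'a \<times> 'b, q :: 'a \<times> 'b). fst p - fst q)"
    by (rule linearI) (auto simp: algebra_simps)
  have "fst ` rel_interior C1 \<inter> fst ` rel_interior C2 \<noteq> {}"
    using assms(3) rel_interior_convex_linear_image[OF linear_fst assms(1)]
      rel_interior_convex_linear_image[OF linear_fst assms(2)] by simp
  then obtain p q where "p \<in> rel_interior C1" "q \<in> rel_interior C2" "fst p = fst q"
    by blast
  then have "0 \<in> (\<lambda>(p, q). fst p - fst q) ` rel_interior (C1 \<times> C2)"
    using rel_interior_Times[OF assms(1,2)] by (intro image_eqI[of _ _ "(p, q)"]) auto
  then show ?thesis
    using rel_interior_convex_linear_image[OF lin convex_Times[OF assms(1,2)]] by simp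
qed

lemma sv_dom_eq_fst_image: "sv_dom F = fst ` sv_gph F"
  by (force simp: sv_dom_def sv_gph_def)

text \<open>The last conclusion transfers the domain condition to projections of convex sets. By
  continuity of the projection, \<open>sv_dom F\<close> lies between the projection of
  \<open>C\<close> and the closure of that projection.\<close>

lemma sv_nearly_convexE:
  fixes F :: "'a::euclidean_space \<Rightarrow> 'b::euclidean_space set"
  assumes "sv_nearly_convex F"
  obtains C where "convex C" "C \<subseteq> sv_gph F" "sv_gph F \<subseteq> closure C"
    "rel_interior (sv_dom F) \<subseteq> rel_interior (fst ` C)"
proof -
  obtain C where C: "convex C" "C \<subseteq> sv_gph F" "sv_gph F \<subseteq> closure C"
    using assms by (auto simp: sv_nearly_convex_def nearly_convex_def)
  have "fst ` closure C \<subseteq> closure (fst ` C)"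
    by (rule closure_bounded_linear_image_subset[OF bounded_linear_fst])
  with C have "fst ` C \<subseteq> sv_dom F" "sv_dom F \<subseteq> closure (fst ` C)"
    unfolding sv_dom_eq_fst_image by auto
  moreover have "convex (fst ` C)"
    using C(1) linear_fst by (rule convex_linear_image[rotated])
  ultimately show ?thesis
    using that C rel_interior_subset_of_between_closure by blast
qed

lemma mem_coderivative_iff:
  "u \<in> coderivative F (x, y) v \<longleftrightarrow>
    (\<forall>a b. b \<in> F a \<longrightarrow> u \<bullet> (a - x) \<le> v \<bullet> (b - y))"
  by (auto simp: coderivative_def normal_cone_def sv_gph_def)

lemma coderivative_sum_subset:
  fixes F1 F2 :: "'a::euclidean_space \<Rightarrow> 'b::euclidean_space set"
  assumes "sv_nearly_convex F1" "sv_nearly_convex F2"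
    and ri: "rel_interior (sv_dom F1) \<inter> rel_interior (sv_dom F2) \<noteq> {}"
    and y1: "y1 \<in> F1 x" and y2: "y2 \<in> F2 x"
  shows "coderivative (sv_sum F1 F2) (x, y1 + y2) v
    \<subseteq> coderivative F1 (x, y1) v + coderivative F2 (x, y2) v"
proof
  fix u assume "u \<in> coderivative (sv_sum F1 F2) (x, y1 + y2) v"
  then have u: "u \<bullet> (a - x) \<le> v \<bullet> (b1 + b2 - (y1 + y2))" if "b1 \<in> F1 a" "b2 \<in> F2 a" for a b1 b2
    using that by (auto simp: mem_coderivative_iff sv_sum_def)
  obtain C1 where C1: "convex C1" "C1 \<subseteq> sv_gph F1" "sv_gph F1 \<subseteq> closure C1"
    "rel_interior (sv_dom F1) \<subseteq> rel_interior (fst ` C1)"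
    using assms(1) by (rule sv_nearly_convexE)
  obtain C2 where C2: "convex C2" "C2 \<subseteq> sv_gph F2" "sv_gph F2 \<subseteq> closure C2"
    "rel_interior (sv_dom F2) \<subseteq> rel_interior (fst ` C2)"
    using assms(2) by (rule sv_nearly_convexE)
  define A :: "('a \<times> 'b) \<times> ('a \<times> 'b) \<Rightarrow> 'a" where "A = (\<lambda>(p, q). fst p - fst q)"
  \<comment> \<open>Only the first base point is paired with \<open>u\<close>. On the constraint set
    the two base points agree, and this choice leads to the split into \<open>u - w\<close> and
    \<open>w\<close>.\<close>
  define h :: "('a \<times> 'b) \<times> ('a \<times> 'b) \<Rightarrow> real" where
    "h = (\<lambda>(p, q). v \<bullet> (snd p - y1) + v \<bullet> (snd q - y2) - u \<bullet> (fst p - x))"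
  have "linear A"
    unfolding A_def by (rule linearI) (auto simp: algebra_simps)
  moreover have "convex_on (C1 \<times> C2) h"
  proof (rule convex_onI)
    fix t :: real and k l :: "('a \<times> 'b) \<times> ('a \<times> 'b)"
    show "h ((1 - t) *\<^sub>R k + t *\<^sub>R l) \<le> (1 - t) * h k + t * h l"
      by (simp add: h_def case_prod_beta inner_simps algebra_simps)
  qed (use C1(1) C2(1) convex_Times in blast)
  moreover have "0 \<in> rel_interior (A ` (C1 \<times> C2))"
    unfolding A_def using ri C1(4) C2(4)
    by (intro zero_in_rel_interior_fst_diff C1(1) C2(1)) blast
  moreover have "\<forall>k\<in>C1 \<times> C2. A k = 0 \<longrightarrow> 0 \<le> h k"
  proof (intro ballI impI)
    fix k assume k_in: "k \<in> C1 \<times> C2" and Ak: "A k = 0"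
    obtain a b1 b2 where k: "k = ((a, b1), (a, b2))"
      using Ak by (cases k) (auto simp: A_def)
    then have "b1 \<in> F1 a" "b2 \<in> F2 a"
      using k_in C1(2) C2(2) by (auto simp: sv_gph_def)
    from u[OF this] show "0 \<le> h k" by (simp add: h_def k inner_simps)
  qed
  ultimately obtain w where w: "\<forall>k\<in>C1 \<times> C2. 0 \<le> h k + w \<bullet> A k"
    by (rule lagrange_multiplier_exists)
  have "closed {k. 0 \<le> h k + w \<bullet> A k}"
    unfolding h_def A_def case_prod_beta by (intro closed_Collect_le continuous_intros)
  then have "closure (C1 \<times> C2) \<subseteq> {k. 0 \<le> h k + w \<bullet> A k}"
    using w by (intro closure_minimal) auto
  then have gph: "0 \<le> h ((a1, b1), (a2, b2)) + w \<bullet> (a1 - a2)" if "b1 \<in> F1 a1" "b2 \<in> F2 a2"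
    for a1 a2 b1 b2
  proof -
    have "((a1, b1), (a2, b2)) \<in> closure (C1 \<times> C2)"
      using that C1(3) C2(3) by (auto simp: closure_Times sv_gph_def)
    then have "((a1, b1), (a2, b2)) \<in> {k. 0 \<le> h k + w \<bullet> A k}"
      using \<open>closure (C1 \<times> C2) \<subseteq> _\<close> by blast
    then show ?thesis by (simp add: A_def)
  qed
  have "(u - w) \<bullet> (a - x) \<le> v \<bullet> (b - y1)" if "b \<in> F1 a" for a b
    using gph[OF that y2] by (simp add: h_def inner_simps)
  then have "u - w \<in> coderivative F1 (x, y1) v"
    by (simp add: mem_coderivative_iff)
  moreover have "w \<bullet> (a - x) \<le> v \<bullet> (b - y2)" if "b \<in> F2 a" for a b
    using gph[OF y1 that] by (simp add: h_def inner_simps)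
  then have "w \<in> coderivative F2 (x, y2) v"
    by (simp add: mem_coderivative_iff)
  ultimately have "(u - w) + w \<in> coderivative F1 (x, y1) v + coderivative F2 (x, y2) v"
    by (rule set_plus_intro)
  then show "u \<in> coderivative F1 (x, y1) v + coderivative F2 (x, y2) v" by simp
qed

text \<open>The inequalities for \<open>u1\<close> and \<open>u2\<close>, taken at the same point
  \<open>a\<close>, add up.\<close>

lemma coderivative_sum_supset:
  "coderivative F1 (x, y1) v + coderivative F2 (x, y2) v
    \<subseteq> coderivative (sv_sum F1 F2) (x, y1 + y2) v"
proof
  fix u assume "u \<in> coderivative F1 (x, y1) v + coderivative F2 (x, y2) v"
  then obtain u1 u2 where u: "u = u1 + u2"
    and u1: "u1 \<in> coderivative F1 (x, y1) v" and u2: "u2 \<in> coderivative F2 (x, y2) v"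
    by (rule set_plus_elim)
  have "u \<bullet> (a - x) \<le> v \<bullet> (b1 + b2 - (y1 + y2))" if "b1 \<in> F1 a" "b2 \<in> F2 a" for a b1 b2
  proof -
    have "u1 \<bullet> (a - x) \<le> v \<bullet> (b1 - y1)" "u2 \<bullet> (a - x) \<le> v \<bullet> (b2 - y2)"
      using u1 u2 that by (auto simp: mem_coderivative_iff)
    then show ?thesis by (simp add: u inner_simps)
  qed
  then show "u \<in> coderivative (sv_sum F1 F2) (x, y1 + y2) v"
    by (auto simp: mem_coderivative_iff sv_sum_def)
qed

theorem theorem5p2:
  fixes F1 F2 :: "real ^ 'n \<Rightarrow> (real ^ 'p) set"
    and x :: "real ^ 'n" and y :: "real ^ 'p"
  assumes "sv_nearly_convex F1" and "sv_nearly_convex F2"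
    and "rel_interior (sv_dom F1) \<inter> rel_interior (sv_dom F2) \<noteq> {}"
    and "(x, y) \<in> sv_gph (sv_sum F1 F2)"
  shows "\<forall>v. \<forall>(y1, y2) \<in> sum_decompositions F1 F2 (x, y).
    coderivative (sv_sum F1 F2) (x, y) v = coderivative F1 (x, y1) v + coderivative F2 (x, y2) v"
proof (intro allI ballI, clarify)
  fix v y1 y2 assume "(y1, y2) \<in> sum_decompositions F1 F2 (x, y)"
  then have "y = y1 + y2" "y1 \<in> F1 x" "y2 \<in> F2 x"
    by (auto simp: sum_decompositions_def)
  then show "coderivative (sv_sum F1 F2) (x, y) v =
      coderivative F1 (x, y1) v + coderivative F2 (x, y2) v"
    using coderivative_sum_subset[OF assms(1-3)] coderivative_sum_supset by blast
qed

end
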